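(* The optimal energy-efficient policy $\bm d^{*}=\arg\max_{\bm d\in\mathcal D}\{\eta^{\bm d}\}$ and the maximal long-run average profit $\eta^{\bm d^*}$ are determined in the following two cases. (a) If $R\ge R_H$, then $\bm d^{*}=(0,0,\dots,0;1,2,\dots,m)$ (that is, $d^*_{n,j}=j$ for $1\le j\le m$), and $$\eta^{\bm d^*}=\sum_{i=0}^{n}\frac{1}{b}\frac{\lambda^i}{i!\mu_1^i}\Big[Ri\mu_1-(nP_{1,W}+mP_{2,S})C_1-iC_2^{(1)}\Big]$$ $$\quad+\sum_{j=1}^{m}\frac1b\frac{\lambda^n}{n!\mu_1^n}\frac{\lambda^j}{\prod_{i=1}^{j}(n\mu_1+i\mu_2)}\Big\{R(n\mu_1+j\mu_2)-[nC_2^{(1)}+jC_2^{(2)}]-[nP_{1,W}+jP_{2,W}+(m-j)P_{2,S}]C_1-n\mu_1C_3-\lambda1_{\{j=m\}}C_4\Big\},$$ where $$b=\sum_{i=0}^{n}\frac{\lambda^i}{i!\mu_1^i}+\frac{\lambda^n}{n!\mu_1^n}\sum_{j=1}^{m}\frac{\lambda^j}{\prod_{i=1}^{j}(n\mu_1+i\mu_2)}.$$ (b) If $0\le R\le R_L$, then $\bm d^{*}=(0,0,\dots,0;0,0,\dots,0)$, and $$\eta^{\bm d^*}=\sum_{i=0}^{n}\frac{1}{b'}\frac{\lambda^i}{i!\mu_1^i}\Big[Ri\mu_1-(nP_{1,W}+mP_{2,S})C_1-iC_2^{(1)}\Big]$$ $$\quad+\sum_{j=1}^{m}\frac1{b'}\frac{\lambda^n}{n!\mu_1^n}\frac{\lambda^j}{(n\mu_1)^j}\Big\{Rn\mu_1-[nP_{1,W}+mP_{2,S}]C_1-[nC_2^{(1)}+jC_2^{(2)}]-n\mu_1C_3-\lambda1_{\{j=m\}}C_4\Big\},$$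 where $$b'=\sum_{i=0}^{n}\frac{\lambda^i}{i!\mu_1^i}+\frac{\lambda^n}{n!\mu_1^n}\sum_{j=1}^{m}\frac{\lambda^j}{(n\mu_1)^j}.$$ Here $\bm d^*=\arg\max$ means that $\bm d^*$ attains the maximum of $\eta^{\bm d}$ over $\bm d\in\mathcal D$.
   Context: Model. Let $n,m\ge1$ be integers and $\lambda>0$, $\mu_1\ge\mu_2>0$. The state space is $\bm\Omega=\{(0,0),(1,0),\dots,(n,0),(n,1),\dots,(n,m)\}$ (in this order). A policy is $\bm d=(0,\dots,0;d_{n,1},\dots,d_{n,m})$ with $d_{n,j}\in\{0,1,\dots,m\}$ (and $d_{i,0}=0$ for $0\le i\le n$); $\mathcal D$ is the set of all policies. Put $\nu(d_{n,j})=n\mu_1+(d_{n,j}\wedge j)\mu_2$ for $1\le j\le m$, where $a\wedge b=\min(a,b)$. $\mathbf B^{(\bm d)}$ is the generator of the birth-death process on $\bm\Omega$ with birth rate $\lambda$ at every state except $(n,m)$ (birth rate $0$ there), death rate $i\mu_1$ at $(i,0)$ for $1\le i\le n$, and death rate $\nu(d_{n,j})$ at $(n,j)$ for $1\le j\le m$. $\bm\pi^{(\bm d)}$ is its unique stationary probability (row) vector. Reward. Let $R\ge 0$ (the service price), $P_{1,W}>0$, $0<P_{2,S}<P_{2,W}$, $C_1>0$, $0\le C_2^{(1)}\le C_2^{(2)}$, $C_3,C_4\ge0$ be constants. For $(i,j)\in\bm\Omega$ put $$A^{(\bm d)}_{i,j}=i\mu_1+(j\wedge d_{i,j})\mu_2,$$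 $$B^{(\bm d)}_{i,j}=[nP_{1,W}+d_{i,j}P_{2,W}+(m-d_{i,j})P_{2,S}]C_1+iC_2^{(1)}+jC_2^{(2)}+i\mu_1 1_{\{j>0\}}C_3+\lambda 1_{\{i=n,j=m\}}C_4 .$$ The reward vector $\bm f^{(\bm d)}$ has entries $f^{(\bm d)}(i,j)=RA^{(\bm d)}_{i,j}-B^{(\bm d)}_{i,j}$, and the long-run average profit is $\eta^{\bm d}=\bm\pi^{(\bm d)}\bm f^{(\bm d)}=RD^{(\bm d)}-F^{(\bm d)}$, where $D^{(\bm d)}=\sum_{(i,j)\in\bm\Omega}\pi^{(\bm d)}(i,j)A^{(\bm d)}_{i,j}$ and $F^{(\bm d)}=\sum_{(i,j)\in\bm\Omega}\pi^{(\bm d)}(i,j)B^{(\bm d)}_{i,j}$. Critical prices. Let $\mathcal B$ be the invertible matrix obtained from $\mathbf B^{(\bm d)}$ by deleting the row and column of state $(0,0)$; its rows and columns are indexed by $\bm\Omega\setminus\{(0,0)\}$. For $0\le j\le m$ let $W^{(\bm d)}_{n,j}$, $V^{(\bm d)}_{n,j}$ and $\gamma^{(\bm d)}_{n,j}$ denote the entries at state $(n,j)$ of, respectively, $(-\mathcal B)^{-1}\bm a$, $(-\mathcal B)^{-1}\bm b$ and $\mu_1(-\mathcal B)^{-1}\bm e_1$, where $\bm a$ has entries $A^{(\bm d)}_{i,j}-D^{(\bm d)}$, $\bm b$ has entries $B^{(\bm d)}_{i,j}-F^{(\bm d)}$ (over $(i,j)\in\bm\Omega\setminus\{(0,0)\}$),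 and $\bm e_1$ is the unit vector at state $(1,0)$. For $1\le j\le m$ define $$\Re^{(\bm d)}_{n,j}=\frac{[V^{(\bm d)}_{n,j-1}-V^{(\bm d)}_{n,j}]-[\gamma^{(\bm d)}_{n,j-1}-\gamma^{(\bm d)}_{n,j}]+\frac{(P_{2,W}-P_{2,S})C_1}{\mu_2}}{1+[W^{(\bm d)}_{n,j-1}-W^{(\bm d)}_{n,j}]},$$ $$R_H=\max_{\bm d\in\mathcal D}\{0,\Re^{(\bm d)}_{n,1},\dots,\Re^{(\bm d)}_{n,m}\},\qquad R_L=\min_{\bm d\in\mathcal D}\{\Re^{(\bm d)}_{n,1},\dots,\Re^{(\bm d)}_{n,m}\}.$$ *)

theory Defs
  imports
    Complex_Main
    "Jordan_Normal_Form.Determinant"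
    "Jordan_Normal_Form.Gauss_Jordan_Elimination"
begin

record data_center =
  n_servers :: nat
  m_servers :: nat
  arrival_rate :: real
  rate1 :: real
  rate2 :: real
  power1W :: real
  power2W :: real
  power2S :: real
  cost1 :: real
  cost2_1 :: real
  cost2_2 :: real
  cost3 :: real
  cost4 :: real

definition states :: "data_center \<Rightarrow> (nat \<times> nat) set" where
  "states S = {(i, 0) |i. i \<le> n_servers S}
     \<union> {(n_servers S, j) |j. 1 \<le> j \<and> j \<le> m_servers S}"

text \<open>In the order (0,0), ..., (n,0), (n,1), ..., (n,m) of the states, the state (i,j)
  has the 0-based position i + j. All vectors and matrices over the state space are indexed
  by this position.\<close>

definition num_states :: "data_center \<Rightarrow> nat" where
  "num_states S = n_servers S + m_servers S + 1"

definition pos :: "nat \<times> nat \<Rightarrow> nat" where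
  "pos s = fst s + snd s"

definition state_at :: "data_center \<Rightarrow> nat \<Rightarrow> nat \<times> nat" where
  "state_at S k = (min k (n_servers S), k - n_servers S)"

lemma state_at_pos: "s \<in> states S \<Longrightarrow> state_at S (pos s) = s"
  by (auto simp: states_def state_at_def pos_def)

lemma pos_state_at: "pos (state_at S k) = k"
  by (auto simp: state_at_def pos_def)

lemma bij_betw_state_at: "bij_betw (state_at S) {..<num_states S} (states S)"
proof (rule bij_betw_byWitness[where f' = pos])
  show "state_at S ` {..<num_states S} \<subseteq> states S"
    by (auto simp: states_def state_at_def num_states_def min_def)
qed (auto simp: state_at_pos pos_state_at, auto simp: states_def pos_def num_states_def)

text \<open>A policy is the function assigning d(i,j) to the state (i,j). It is set to 0 outside
  the state space, so that policies that agree on the state space are equal and there are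
  only finitely many of them.\<close>

type_synonym policy = "nat \<times> nat \<Rightarrow> nat"

definition policies :: "data_center \<Rightarrow> policy set" where
  "policies S = {d. (\<forall>i \<le> n_servers S. d (i, 0) = 0)
     \<and> (\<forall>j \<in> {1..m_servers S}. d (n_servers S, j) \<le> m_servers S)
     \<and> (\<forall>s. s \<notin> states S \<longrightarrow> d s = 0)}"

definition birth_rate :: "data_center \<Rightarrow> nat \<times> nat \<Rightarrow> real" where
  "birth_rate S s = (if s = (n_servers S, m_servers S) then 0 else arrival_rate S)"

definition death_rate :: "data_center \<Rightarrow> policy \<Rightarrow> nat \<times> nat \<Rightarrow> real" where
  "death_rate S d = (\<lambda>(i, j).
     if j = 0 then real i * rate1 S
     else real (n_servers S) * rate1 S + real (min (d (n_servers S, j)) j) * rate2 S)"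

definition generator :: "data_center \<Rightarrow> policy \<Rightarrow> real mat" where
  "generator S d = mat (num_states S) (num_states S) (\<lambda>(k, l).
     if l = k + 1 then birth_rate S (state_at S k)
     else if k = l + 1 then death_rate S d (state_at S k)
     else if k = l then - (birth_rate S (state_at S k) + death_rate S d (state_at S k))
     else 0)"

text \<open>The equation for the row vector p, that p times the generator vanishes, is written
  in transposed form.\<close>

definition is_stationary :: "data_center \<Rightarrow> policy \<Rightarrow> real vec \<Rightarrow> bool" where
  "is_stationary S d p \<longleftrightarrow> p \<in> carrier_vec (num_states S)
     \<and> (\<forall>k < num_states S. 0 \<le> p $ k)
     \<and> (\<Sum>k < num_states S. p $ k) = 1
     \<and> transpose_mat (generator S d) *\<^sub>v p = 0\<^sub>v (num_states S)"

definition stationary :: "data_center \<Rightarrow> policy \<Rightarrow> real vec" where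
  "stationary S d = (THE p. is_stationary S d p)"

definition rev_A :: "data_center \<Rightarrow> policy \<Rightarrow> nat \<times> nat \<Rightarrow> real" where
  "rev_A S d = (\<lambda>(i, j). real i * rate1 S + real (min j (d (i, j))) * rate2 S)"

definition cost_B :: "data_center \<Rightarrow> policy \<Rightarrow> nat \<times> nat \<Rightarrow> real" where
  "cost_B S d = (\<lambda>(i, j).
     (real (n_servers S) * power1W S + real (d (i, j)) * power2W S
        + (real (m_servers S) - real (d (i, j))) * power2S S) * cost1 S
     + real i * cost2_1 S + real j * cost2_2 S
     + real i * rate1 S * of_bool (j > 0) * cost3 S
     + arrival_rate S * of_bool (i = n_servers S \<and> j = m_servers S) * cost4 S)"

definition reward :: "data_center \<Rightarrow> real \<Rightarrow> policy \<Rightarrow> real vec" where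
  "reward S R d = vec (num_states S)
     (\<lambda>k. R * rev_A S d (state_at S k) - cost_B S d (state_at S k))"

definition avg_profit :: "data_center \<Rightarrow> real \<Rightarrow> policy \<Rightarrow> real" where
  "avg_profit S R d = stationary S d \<bullet> reward S R d"

definition avg_A :: "data_center \<Rightarrow> policy \<Rightarrow> real" where
  "avg_A S d = (\<Sum>s \<in> states S. stationary S d $ pos s * rev_A S d s)"

definition avg_B :: "data_center \<Rightarrow> policy \<Rightarrow> real" where
  "avg_B S d = (\<Sum>s \<in> states S. stationary S d $ pos s * cost_B S d s)"

text \<open>The generator without the row and column of (0,0). After the deletion the position of
  every remaining state is smaller by one.\<close>

definition reduced_generator :: "data_center \<Rightarrow> policy \<Rightarrow> real mat" where
  "reduced_generator S d = mat_delete (generator S d) 0 0"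

definition neg_inverse :: "data_center \<Rightarrow> policy \<Rightarrow> real mat" where
  "neg_inverse S d = the (mat_inverse (- reduced_generator S d))"

definition reduced_vec :: "data_center \<Rightarrow> (nat \<times> nat \<Rightarrow> real) \<Rightarrow> real vec" where
  "reduced_vec S g = vec (num_states S - 1) (\<lambda>k. g (state_at S (k + 1)))"

definition reduced_entry :: "real vec \<Rightarrow> nat \<times> nat \<Rightarrow> real" where
  "reduced_entry v s = v $ (pos s - 1)"

definition potential_W :: "data_center \<Rightarrow> policy \<Rightarrow> nat \<Rightarrow> real" where
  "potential_W S d j = reduced_entry
     (neg_inverse S d *\<^sub>v reduced_vec S (\<lambda>s. rev_A S d s - avg_A S d)) (n_servers S, j)"

definition potential_V :: "data_center \<Rightarrow> policy \<Rightarrow> nat \<Rightarrow> real" where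
  "potential_V S d j = reduced_entry
     (neg_inverse S d *\<^sub>v reduced_vec S (\<lambda>s. cost_B S d s - avg_B S d)) (n_servers S, j)"

definition potential_gamma :: "data_center \<Rightarrow> policy \<Rightarrow> nat \<Rightarrow> real" where
  "potential_gamma S d j = reduced_entry
     (rate1 S \<cdot>\<^sub>v (neg_inverse S d *\<^sub>v reduced_vec S (\<lambda>s. of_bool (s = (1, 0)))))
     (n_servers S, j)"

definition critical_price :: "data_center \<Rightarrow> policy \<Rightarrow> nat \<Rightarrow> real" where
  "critical_price S d j =
     ((potential_V S d (j - 1) - potential_V S d j)
        - (potential_gamma S d (j - 1) - potential_gamma S d j)
        + (power2W S - power2S S) * cost1 S / rate2 S)
     / (1 + (potential_W S d (j - 1) - potential_W S d j))"

definition price_H :: "data_center \<Rightarrow> real" where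
  "price_H S = Max (insert 0
     {critical_price S d j |d j. d \<in> policies S \<and> j \<in> {1..m_servers S}})"

definition price_L :: "data_center \<Rightarrow> real" where
  "price_L S = Min {critical_price S d j |d j. d \<in> policies S \<and> j \<in> {1..m_servers S}}"

definition full_policy :: "data_center \<Rightarrow> policy" where
  "full_policy S = (\<lambda>(i, j).
     if i = n_servers S \<and> 1 \<le> j \<and> j \<le> m_servers S then j else 0)"

definition sleep_policy :: policy where
  "sleep_policy = (\<lambda>_. 0)"

end

theory Submission
  imports Defs
begin

text \<open>Write g = R W - V. Then g solves the Poisson equation of the policy d, so for any other
  policy d' the profit difference is the d'-stationary average of
  (nu(d') - nu(d)) (R + g(n,j-1) - g(n,j)) minus the extra power cost of d'. For work rates up to j
  this is (d' - d) mu2 (1 + W(n,j-1) - W(n,j)) (R - critical price of d), and waking more than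
  j servers only costs power. Since 1 + W(n,j-1) - W(n,j) is positive, comparing every policy
  with the full policy (resp. the sleep policy) alone decides optimality. The term gamma plays no
  role because it has the same value at all states (n,j).\<close>

section \<open>Birth-death operators on functions of the position\<close>

text \<open>At k = 0 truncated subtraction gives k - 1 = 0, so the death term vanishes there whatever
  the value of the death rate.\<close>

definition bd_op :: "(nat \<Rightarrow> real) \<Rightarrow> (nat \<Rightarrow> real) \<Rightarrow> (nat \<Rightarrow> real) \<Rightarrow> nat \<Rightarrow> real" where
  "bd_op \<beta> \<mu> x k = \<beta> k * (x (Suc k) - x k) + \<mu> k * (x (k - 1) - x k)"

lemma bd_op_diff:
  "bd_op \<beta> \<mu>' x k - bd_op \<beta> \<mu> x k = (\<mu>' k - \<mu> k) * (x (k - 1) - x k)"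
  by (simp add: bd_op_def algebra_simps)

lemma bd_op_lincomb:
  "bd_op \<beta> \<mu> (\<lambda>k. r * x k - y k) k = r * bd_op \<beta> \<mu> x k - bd_op \<beta> \<mu> y k"
  by (simp add: bd_op_def algebra_simps)

text \<open>Downward induction from \<open>N\<close>: there \<open>\<beta> N = 0\<close> leaves only
  the death term, and once \<open>x k = x (Suc k)\<close> is known the birth term at
  \<open>k\<close> vanishes as well. It serves for the injectivity of the reduced generator and for
  the constancy of gamma.\<close>

lemma bd_op_eq_0_imp_const:
  assumes "\<beta> N = 0" and \<mu>: "\<And>k. a \<le> k \<Longrightarrow> k \<le> N \<Longrightarrow> \<mu> k > 0"
    and x: "\<And>k. a \<le> k \<Longrightarrow> k \<le> N \<Longrightarrow> bd_op \<beta> \<mu> x k = 0"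
    and "a \<le> k" "k \<le> N"
  shows "x (k - 1) = x k"
  using \<open>k \<le> N\<close> \<open>a \<le> k\<close>
proof (induction k rule: inc_induct)
  case base
  then show ?case using x[of N] \<mu>[of N] \<open>\<beta> N = 0\<close> by (simp add: bd_op_def)
next
  case (step k)
  then show ?case using x[of k] \<mu>[of k] by (simp add: bd_op_def)
qed

text \<open>Summation by parts: detailed balance cancels the flux between neighbours, so only the
  flux from \<open>K\<close> to \<open>Suc K\<close> survives. When \<open>\<beta> K = 0\<close> the
  sum is zero, which yields the invariance of the product form.\<close>

lemma sum_bd_op_partial:
  fixes p :: "nat \<Rightarrow> real"
  assumes "\<And>k. k < K \<Longrightarrow> p (Suc k) * \<mu> (Suc k) = p k * \<beta> k"
  shows "(\<Sum>k<Suc K. p k * bd_op \<beta> \<mu> x k) = p K * \<beta> K * (x (Suc K) - x K)"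
  using assms
proof (induction K)
  case 0
  show ?case by (simp add: bd_op_def)
next
  case (Suc K)
  have "(\<Sum>k<Suc (Suc K). p k * bd_op \<beta> \<mu> x k)
      = p K * \<beta> K * (x (Suc K) - x K) + p (Suc K) * bd_op \<beta> \<mu> x (Suc K)"
    using Suc by simp
  also have "\<dots> = p (Suc K) * \<beta> (Suc K) * (x (Suc (Suc K)) - x (Suc K))"
    unfolding Suc.prems[OF lessI, symmetric] by (simp add: bd_op_def algebra_simps)
  finally show ?case .
qed

lemma cut_equation:
  fixes p :: "nat \<Rightarrow> real"
  assumes inv: "\<And>x. (\<Sum>k<Suc N. p k * bd_op \<beta> \<mu> x k) = 0" and "k < N"
  shows "p (Suc k) * \<mu> (Suc k) = p k * \<beta> k"
proof -
  \<comment> \<open>This indicator changes only across the cut between \<open>k\<close> and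
    \<open>Suc k\<close>, so testing with it isolates the flow through that cut.\<close>
  let ?x = "\<lambda>l. of_bool (l \<le> k) :: real"
  have "p l * bd_op \<beta> \<mu> ?x l
      = (if l = k then - p k * \<beta> k else 0) + (if l = Suc k then p (Suc k) * \<mu> (Suc k) else 0)" for l
    by (cases "l = Suc k") (auto simp: bd_op_def not_le)
  then have "(\<Sum>l<Suc N. p l * bd_op \<beta> \<mu> ?x l) = - p k * \<beta> k + p (Suc k) * \<mu> (Suc k)"
    using \<open>k < N\<close> by (simp add: sum.distrib)
  with inv[of ?x] show ?thesis by simp
qed

lemma sum_tridiagonal:
  fixes x :: "nat \<Rightarrow> real"
  assumes "k < M" and "Suc k = M \<Longrightarrow> \<beta> k = 0" and "\<mu> 0 = 0"
  shows "(\<Sum>l<M. (if l = k + 1 then \<beta> k else if k = l + 1 then \<mu> k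
      else if k = l then - (\<beta> k + \<mu> k) else 0) * x l) = bd_op \<beta> \<mu> x k"
proof -
  \<comment> \<open>For \<open>k = 0\<close> the index \<open>k - 1\<close> is again 0; the spurious
    summand this creates vanishes by \<open>\<mu> 0 = 0\<close>.\<close>
  have "(if l = k + 1 then \<beta> k else if k = l + 1 then \<mu> k
      else if k = l then - (\<beta> k + \<mu> k) else 0) * x l
    = (if l = Suc k then \<beta> k * x (Suc k) else 0) + (if l = k - 1 then \<mu> k * x (k - 1) else 0)
      + (if l = k then - (\<beta> k + \<mu> k) * x k else 0)" for l
    using \<open>\<mu> 0 = 0\<close> by (cases k) auto
  then have "(\<Sum>l<M. (if l = k + 1 then \<beta> k else if k = l + 1 then \<mu> k
      else if k = l then - (\<beta> k + \<mu> k) else 0) * x l)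
    = (if Suc k < M then \<beta> k * x (Suc k) else 0) + \<mu> k * x (k - 1) - (\<beta> k + \<mu> k) * x k"
    using \<open>k < M\<close> by (simp add: sum.distrib less_imp_diff_less algebra_simps)
  also have "\<dots> = bd_op \<beta> \<mu> x k"
    using assms by (auto simp: bd_op_def algebra_simps)
  finally show ?thesis .
qed

section \<open>The generator of the model as a birth-death operator\<close>

locale energy_model =
  fixes S :: data_center
  assumes n_pos: "n_servers S \<ge> 1" and m_pos: "m_servers S \<ge> 1"
    and arrival_pos: "arrival_rate S > 0"
    and rate1_pos: "rate1 S > 0" and rate2_pos: "rate2 S > 0"
begin

abbreviation (input) "n \<equiv> n_servers S"
abbreviation (input) "m \<equiv> m_servers S"
abbreviation (input) "lam \<equiv> arrival_rate S"
abbreviation (input) "N \<equiv> n_servers S + m_servers S"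

definition \<beta> :: "nat \<Rightarrow> real" where "\<beta> k = birth_rate S (state_at S k)"
definition \<mu> :: "policy \<Rightarrow> nat \<Rightarrow> real" where "\<mu> d k = death_rate S d (state_at S k)"

lemma num_states_eq: "num_states S = Suc N"
  by (simp add: num_states_def)

lemma \<beta>_eq: "\<beta> k = (if k = N then 0 else lam)"
  using m_pos by (auto simp: \<beta>_def birth_rate_def state_at_def)

lemma \<mu>_low: "k \<le> n \<Longrightarrow> \<mu> d k = real k * rate1 S"
  by (simp add: \<mu>_def death_rate_def state_at_def)

lemma \<mu>_high:
  "1 \<le> j \<Longrightarrow> \<mu> d (n + j) = real n * rate1 S + real (min (d (n, j)) j) * rate2 S"
  by (simp add: \<mu>_def death_rate_def state_at_def)

lemma \<mu>_pos: "1 \<le> k \<Longrightarrow> \<mu> d k > 0"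
proof (cases "k \<le> n")
  case False
  then have "k = n + (k - n)" "1 \<le> k - n" by auto
  then obtain j where "k = n + j" "1 \<le> j" by blast
  then show ?thesis
    using n_pos rate1_pos rate2_pos by (simp add: \<mu>_high add_pos_nonneg)
qed (use rate1_pos in \<open>simp add: \<mu>_low\<close>)

lemma generator_carrier: "generator S d \<in> carrier_mat (num_states S) (num_states S)"
  by (simp add: generator_def)

lemma generator_index:
  "k < num_states S \<Longrightarrow> l < num_states S \<Longrightarrow> generator S d $$ (k, l) =
    (if l = k + 1 then \<beta> k else if k = l + 1 then \<mu> d k
      else if k = l then - (\<beta> k + \<mu> d k) else 0)"
  by (simp add: generator_def \<beta>_def \<mu>_def)

lemma generator_row:
  assumes "k < num_states S"
  shows "(\<Sum>l<num_states S. generator S d $$ (k, l) * x l) = bd_op \<beta> (\<mu> d) x k"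
proof -
  have "(\<Sum>l<num_states S. generator S d $$ (k, l) * x l)
    = (\<Sum>l<num_states S. (if l = k + 1 then \<beta> k else if k = l + 1 then \<mu> d k
      else if k = l then - (\<beta> k + \<mu> d k) else 0) * x l)"
    using assms by (intro sum.cong) (simp_all add: generator_index)
  also have "\<dots> = bd_op \<beta> (\<mu> d) x k"
    using assms by (intro sum_tridiagonal) (auto simp: num_states_eq \<beta>_eq \<mu>_low)
  finally show ?thesis .
qed

lemma generator_adjoint:
  assumes "p \<in> carrier_vec (num_states S)"
  shows "(transpose_mat (generator S d) *\<^sub>v p) \<bullet> vec (num_states S) x
    = (\<Sum>k<Suc N. p $ k * bd_op \<beta> (\<mu> d) x k)"
proof -
  have "(transpose_mat (generator S d) *\<^sub>v p) \<bullet> vec (num_states S) x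
      = p \<bullet> (generator S d *\<^sub>v vec (num_states S) x)"
    by (rule transpose_vec_mult_scalar[OF generator_carrier _ assms]) simp
  also have "\<dots> = (\<Sum>k<num_states S. p $ k * (\<Sum>l<num_states S. generator S d $$ (k, l) * x l))"
    using generator_carrier[of d]
    by (auto simp: scalar_prod_def atLeast0LessThan intro!: sum.cong)
  also have "\<dots> = (\<Sum>k<Suc N. p $ k * bd_op \<beta> (\<mu> d) x k)"
    unfolding num_states_eq[symmetric] by (simp add: generator_row)
  finally show ?thesis .
qed

text \<open>Weak form of stationarity: the generator is moved from \<open>p\<close> onto a test
  function, where it acts as \<open>bd_op\<close>. Unit vectors as test functions recover the single
  coordinates.\<close>

lemma stationary_equation_iff:
  assumes "p \<in> carrier_vec (num_states S)"
  shows "transpose_mat (generator S d) *\<^sub>v p = 0\<^sub>v (num_states S)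
    \<longleftrightarrow> (\<forall>x. (\<Sum>k<Suc N. p $ k * bd_op \<beta> (\<mu> d) x k) = 0)"
proof
  assume "transpose_mat (generator S d) *\<^sub>v p = 0\<^sub>v (num_states S)"
  then show "\<forall>x. (\<Sum>k<Suc N. p $ k * bd_op \<beta> (\<mu> d) x k) = 0"
    using generator_adjoint[OF assms, of d] by simp
next
  assume inv: "\<forall>x. (\<Sum>k<Suc N. p $ k * bd_op \<beta> (\<mu> d) x k) = 0"
  show "transpose_mat (generator S d) *\<^sub>v p = 0\<^sub>v (num_states S)" (is "?q = _")
  proof (rule eq_vecI)
    have q: "?q \<in> carrier_vec (num_states S)"
      by (rule mult_mat_vec_carrier[OF _ assms]) (simp add: generator_carrier)
    show "dim_vec ?q = dim_vec (0\<^sub>v (num_states S))"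
      using carrier_vecD[OF q] by (simp only: index_zero_vec)
    fix l assume "l < dim_vec (0\<^sub>v (num_states S) :: real vec)"
    then have l: "l < num_states S" by simp
    then have "?q $ l = ?q \<bullet> unit_vec (num_states S) l"
      using q by (simp add: scalar_prod_right_unit)
    also have "\<dots> = 0"
      unfolding unit_vec_def generator_adjoint[OF assms] using inv by simp
    finally show "?q $ l = 0\<^sub>v (num_states S) $ l" using l by simp
  qed
qed

section \<open>Product form of the stationary distribution\<close>

text \<open>Unnormalized product-form weights. Every step up to position \<open>N\<close> has the
  birth rate \<open>lam\<close>.\<close>

definition wt :: "policy \<Rightarrow> nat \<Rightarrow> real" where
  "wt d k = (\<Prod>i=1..k. lam / \<mu> d i)"

definition \<pi> :: "policy \<Rightarrow> nat \<Rightarrow> real" where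
  "\<pi> d k = wt d k / (\<Sum>l<Suc N. wt d l)"

lemma wt_pos: "wt d k > 0"
  unfolding wt_def using arrival_pos \<mu>_pos by (intro prod_pos) auto

lemma sum_wt_pos: "(\<Sum>l<Suc N. wt d l) > 0"
  using wt_pos by (intro sum_pos) auto

lemma \<pi>_pos: "\<pi> d k > 0"
  unfolding \<pi>_def using wt_pos sum_wt_pos by simp

lemma sum_\<pi>: "(\<Sum>k<Suc N. \<pi> d k) = 1"
  using sum_wt_pos[of d] unfolding \<pi>_def sum_divide_distrib[symmetric] by simp

lemma \<pi>_cut: "k < N \<Longrightarrow> \<pi> d (Suc k) * \<mu> d (Suc k) = \<pi> d k * \<beta> k"
  using \<mu>_pos[of "Suc k" d] by (simp add: \<pi>_def wt_def \<beta>_eq)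

lemma \<pi>_invariant: "(\<Sum>k<Suc N. \<pi> d k * bd_op \<beta> (\<mu> d) x k) = 0"
  using sum_bd_op_partial[where K = N and p = "\<pi> d", OF \<pi>_cut] unfolding \<beta>_eq[of N] by simp

text \<open>Gives the existence and uniqueness on which the description operator in
  \<open>stationary\<close> depends. Uniqueness holds because the cut equations fix \<open>p\<close>
  up to the factor \<open>p $ 0\<close>, and the total mass 1 fixes that factor.\<close>

lemma is_stationary_iff: "is_stationary S d p \<longleftrightarrow> p = vec (num_states S) (\<pi> d)"
proof
  assume p: "p = vec (num_states S) (\<pi> d)"
  have "(\<Sum>k<Suc N. p $ k * bd_op \<beta> (\<mu> d) x k) = 0" for x
    using \<pi>_invariant[of d x] unfolding p by (simp add: num_states_eq)
  then show "is_stationary S d p"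
    using \<pi>_pos[of d] sum_\<pi>[of d] stationary_equation_iff[of p d]
    unfolding is_stationary_def by (simp add: p num_states_eq less_imp_le)
next
  assume st: "is_stationary S d p"
  then have p: "p \<in> carrier_vec (num_states S)" and sum: "(\<Sum>k<Suc N. p $ k) = 1"
    and "\<And>x. (\<Sum>k<Suc N. p $ k * bd_op \<beta> (\<mu> d) x k) = 0"
    using stationary_equation_iff[of p d] by (auto simp: is_stationary_def num_states_eq)
  then have cut: "p $ Suc k * \<mu> d (Suc k) = p $ k * \<beta> k" if "k < N" for k
    using cut_equation[where p = "\<lambda>k. p $ k" and N = N] that by blast
  have wt: "p $ k = p $ 0 * wt d k" if "k \<le> N" for k
    using that
  proof (induction k)
    case (Suc k)
    then have "p $ Suc k = p $ k * (lam / \<mu> d (Suc k))"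
      using cut[of k] \<mu>_pos[of "Suc k" d] by (simp add: \<beta>_eq field_simps)
    also have "p $ k = p $ 0 * wt d k" using Suc by simp
    finally show ?case by (simp add: wt_def)
  qed (simp add: wt_def)
  have "p $ 0 * (\<Sum>k<Suc N. wt d k) = (\<Sum>k<Suc N. p $ k)"
    unfolding sum_distrib_left by (intro sum.cong refl wt[symmetric]) simp
  then have p0: "p $ 0 = 1 / (\<Sum>k<Suc N. wt d k)"
    using sum sum_wt_pos[of d] by (simp add: field_simps)
  show "p = vec (num_states S) (\<pi> d)"
  proof (rule eq_vecI)
    fix k assume "k < dim_vec (vec (num_states S) (\<pi> d))"
    then have "k \<le> N" by (simp add: num_states_eq)
    then have "p $ k = \<pi> d k"
      unfolding \<pi>_def wt[OF \<open>k \<le> N\<close>] p0 by simp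
    then show "p $ k = vec (num_states S) (\<pi> d) $ k"
      using \<open>k \<le> N\<close> by (simp add: num_states_eq)
  qed (use p in simp)
qed

lemma stationary_eq: "stationary S d = vec (num_states S) (\<pi> d)"
  by (simp add: stationary_def is_stationary_iff)

section \<open>Averages of revenue, cost and profit\<close>

definition rA :: "policy \<Rightarrow> nat \<Rightarrow> real" where "rA d k = rev_A S d (state_at S k)"
definition cB :: "policy \<Rightarrow> nat \<Rightarrow> real" where "cB d k = cost_B S d (state_at S k)"

lemma sum_states:
  "(\<Sum>s\<in>states S. stationary S d $ pos s * h s) = (\<Sum>k<Suc N. \<pi> d k * h (state_at S k))"
proof -
  have "(\<Sum>s\<in>states S. stationary S d $ pos s * h s)
     = (\<Sum>k<num_states S. stationary S d $ pos (state_at S k) * h (state_at S k))"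
    by (rule sum.reindex_bij_betw[OF bij_betw_state_at, symmetric])
  then show ?thesis by (simp add: pos_state_at stationary_eq num_states_eq)
qed

lemma avg_A_eq: "avg_A S d = (\<Sum>k<Suc N. \<pi> d k * rA d k)"
  by (simp add: avg_A_def sum_states rA_def)

lemma avg_B_eq: "avg_B S d = (\<Sum>k<Suc N. \<pi> d k * cB d k)"
  by (simp add: avg_B_def sum_states cB_def)

lemma avg_profit_eq: "avg_profit S R d = (\<Sum>k<Suc N. \<pi> d k * (R * rA d k - cB d k))"
  by (simp add: avg_profit_def scalar_prod_def stationary_eq reward_def num_states_eq
      rA_def cB_def atLeast0LessThan)

lemma avg_profit_decomp: "avg_profit S R d = R * avg_A S d - avg_B S d"
  unfolding avg_profit_eq avg_A_eq avg_B_eq sum_distrib_left sum_subtractf[symmetric]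
  by (intro sum.cong) (simp_all add: algebra_simps)

text \<open>\<open>rev_A\<close> counts service completions and the death rate counts departures,
  which are the same events. This ties W to the balance of arrivals and departures.\<close>

lemma rA_eq_\<mu>:
  assumes "d \<in> policies S" "k \<le> N"
  shows "rA d k = \<mu> d k"
  using assms by (auto simp: rA_def \<mu>_def rev_A_def death_rate_def state_at_def policies_def min.commute min_def)

section \<open>The reduced generator, its inverse and the Poisson equation\<close>

text \<open>Deleting the column of (0,0) amounts to extending the vector by the value 0 at position
  0. The row of position \<open>k\<close> becomes row \<open>k - 1\<close> of the reduced
  matrix.\<close>

lemma reduced_generator_mult:
  assumes "v \<in> carrier_vec N" and "1 \<le> k" "k \<le> N"
    and x: "\<And>l. l < N \<Longrightarrow> x (Suc l) = v $ l" "x 0 = 0"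
  shows "((- reduced_generator S d) *\<^sub>v v) $ (k - 1) = - bd_op \<beta> (\<mu> d) x k"
proof -
  have dim: "dim_row (reduced_generator S d) = N" "dim_col (reduced_generator S d) = N"
    using generator_carrier[of d] by (simp_all add: reduced_generator_def num_states_eq)
  have idx: "reduced_generator S d $$ (i, l) = generator S d $$ (Suc i, Suc l)"
    if "i < N" "l < N" for i l
    using that generator_carrier[of d]
    by (simp add: reduced_generator_def mat_delete_def num_states_eq)
  have "((- reduced_generator S d) *\<^sub>v v) $ (k - 1)
     = (\<Sum>l<N. - generator S d $$ (k, Suc l) * x (Suc l))"
    using assms dim idx by (simp add: scalar_prod_def atLeast0LessThan sum_negf)
  also have "\<dots> = - (\<Sum>l<Suc N. generator S d $$ (k, l) * x l)"
    unfolding sum.lessThan_Suc_shift by (simp add: x sum_negf)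
  also have "\<dots> = - bd_op \<beta> (\<mu> d) x k"
    using generator_row[of k d x] assms by (simp add: num_states_eq)
  finally show ?thesis .
qed

lemma reduced_generator_carrier: "- reduced_generator S d \<in> carrier_mat N N"
  using generator_carrier[of d]
  by (intro carrier_matI) (simp_all add: reduced_generator_def num_states_eq)

lemma neg_inverse_correct:
  shows "neg_inverse S d \<in> carrier_mat N N"
    and "- reduced_generator S d * neg_inverse S d = 1\<^sub>m N"
proof -
  let ?A = "- reduced_generator S d"
  have "det ?A \<noteq> 0"
  proof
    assume "det ?A = 0"
    then obtain v where v: "v \<in> carrier_vec N" "v \<noteq> 0\<^sub>v N" "?A *\<^sub>v v = 0\<^sub>v N"
      using det_0_iff_vec_prod_zero_field[OF reduced_generator_carrier] by blast
    \<comment> \<open>A kernel vector, extended by 0 at position 0, solves the homogeneous equation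
      at the positions 1 to \<open>N\<close>; it is therefore constant, and its value at 0 makes it
      zero.\<close>
    define x where "x k = (if k = 0 then 0 else v $ (k - 1))" for k
    have "bd_op \<beta> (\<mu> d) x k = 0" if "1 \<le> k" "k \<le> N" for k
      using reduced_generator_mult[OF v(1) that, of x d] that v(3) by (simp add: x_def)
    then have step: "x (k - 1) = x k" if "1 \<le> k" "k \<le> N" for k
      using bd_op_eq_0_imp_const[of \<beta> N 1 "\<mu> d" x k] that \<mu>_pos by (simp add: \<beta>_eq)
    have "x k = 0" if "k \<le> N" for k
      using that
    proof (induction k)
      case (Suc k)
      then show ?case using step[of "Suc k"] by simp
    qed (simp add: x_def)
    then have "v $ k = 0" if "k < N" for k
      using that by (metis Suc_leI diff_Suc_1 nat.distinct(1) x_def)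
    then have "v = 0\<^sub>v N" using v(1) by (intro eq_vecI) auto
    with v(2) show False by simp
  qed
  \<comment> \<open>\<open>mat_inverse\<close> returns \<open>None\<close> only for matrices that
    are not units of the matrix ring, so the \<open>the\<close> in \<open>neg_inverse\<close> does
    pick an inverse.\<close>
  then have unit: "?A \<in> Units (ring_mat TYPE(real) N ())"
    by (rule det_non_zero_imp_unit[OF reduced_generator_carrier])
  have "mat_inverse ?A \<noteq> None"
  proof
    assume "mat_inverse ?A = None"
    from mat_inverse(1)[OF reduced_generator_carrier this, where b = "()"] unit show False by blast
  qed
  then obtain B where "mat_inverse ?A = Some B" by blast
  then show "neg_inverse S d \<in> carrier_mat N N" "?A * neg_inverse S d = 1\<^sub>m N"
    using mat_inverse(2)[OF reduced_generator_carrier] by (auto simp: neg_inverse_def)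
qed

text \<open>Solution of the reduced system, extended by 0 at (0,0) so that \<open>bd_op\<close>
  applies to it. W, V and, up to the factor mu1, gamma are instances.\<close>

definition reduced_solution :: "policy \<Rightarrow> (nat \<times> nat \<Rightarrow> real) \<Rightarrow> nat \<Rightarrow> real" where
  "reduced_solution d h k = (if k = 0 then 0 else (neg_inverse S d *\<^sub>v reduced_vec S h) $ (k - 1))"

lemma bd_op_reduced_solution:
  assumes "1 \<le> k" "k \<le> N"
  shows "bd_op \<beta> (\<mu> d) (reduced_solution d h) k = - h (state_at S k)"
proof -
  let ?v = "neg_inverse S d *\<^sub>v reduced_vec S h"
  have r: "reduced_vec S h \<in> carrier_vec N"
    by (simp add: reduced_vec_def num_states_eq)
  have v: "?v \<in> carrier_vec N"
    by (rule mult_mat_vec_carrier[OF neg_inverse_correct(1) r])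
  have "- reduced_generator S d *\<^sub>v ?v = (- reduced_generator S d * neg_inverse S d) *\<^sub>v reduced_vec S h"
    by (rule assoc_mult_mat_vec[OF reduced_generator_carrier neg_inverse_correct(1) r, symmetric])
  then have eq: "- reduced_generator S d *\<^sub>v ?v = reduced_vec S h"
    using r by (simp add: neg_inverse_correct)
  have "- bd_op \<beta> (\<mu> d) (reduced_solution d h) k = reduced_vec S h $ (k - 1)"
    using reduced_generator_mult[OF v assms, of "reduced_solution d h" d] unfolding eq by (simp add: reduced_solution_def)
  also have "\<dots> = h (state_at S k)"
    using assms by (cases k) (simp_all add: reduced_vec_def num_states_eq)
  finally show ?thesis by simp
qed

text \<open>The equation at (0,0), which the reduced system omits, is recovered from the invariance
  of the stationary distribution.\<close>

lemma bd_op_reduced_solution_centered: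
  assumes "(\<Sum>k<Suc N. \<pi> d k * h (state_at S k)) = 0" and "k \<le> N"
  shows "bd_op \<beta> (\<mu> d) (reduced_solution d h) k = - h (state_at S k)"
proof (cases "k = 0")
  case True
  let ?e = "\<lambda>k. \<pi> d k * (bd_op \<beta> (\<mu> d) (reduced_solution d h) k + h (state_at S k))"
  have "0 = (\<Sum>k<Suc N. ?e k)"
    using assms(1) \<pi>_invariant[of d "reduced_solution d h"] by (simp only: distrib_left sum.distrib)
  also have "\<dots> = ?e 0"
    unfolding sum.lessThan_Suc_shift using bd_op_reduced_solution[of _ d h] by simp
  finally show ?thesis using \<pi>_pos[of d 0] True by simp
qed (use assms bd_op_reduced_solution in auto)

lemma sum_\<pi>_centered: "(\<Sum>k<Suc N. \<pi> d k * (f k - (\<Sum>k<Suc N. \<pi> d k * f k))) = 0"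
  unfolding right_diff_distrib sum_subtractf sum_distrib_right[symmetric] sum_\<pi> by simp

definition pW :: "policy \<Rightarrow> nat \<Rightarrow> real" where
  "pW d = reduced_solution d (\<lambda>s. rev_A S d s - avg_A S d)"
definition pV :: "policy \<Rightarrow> nat \<Rightarrow> real" where
  "pV d = reduced_solution d (\<lambda>s. cost_B S d s - avg_B S d)"

lemma bd_op_pW:
  assumes "k \<le> N"
  shows "bd_op \<beta> (\<mu> d) (pW d) k = avg_A S d - rA d k"
proof -
  have "(\<Sum>k<Suc N. \<pi> d k * (rev_A S d (state_at S k) - avg_A S d)) = 0"
    using sum_\<pi>_centered[of d "rA d"] unfolding avg_A_eq rA_def .
  from bd_op_reduced_solution_centered[where h = "\<lambda>s. rev_A S d s - avg_A S d", OF this assms]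
  show ?thesis by (simp add: pW_def rA_def)
qed

lemma bd_op_pV:
  assumes "k \<le> N"
  shows "bd_op \<beta> (\<mu> d) (pV d) k = avg_B S d - cB d k"
proof -
  have "(\<Sum>k<Suc N. \<pi> d k * (cost_B S d (state_at S k) - avg_B S d)) = 0"
    using sum_\<pi>_centered[of d "cB d"] unfolding avg_B_eq cB_def .
  from bd_op_reduced_solution_centered[where h = "\<lambda>s. cost_B S d s - avg_B S d", OF this assms]
  show ?thesis by (simp add: pV_def cB_def)
qed

lemma potential_W_eq: "potential_W S d j = pW d (n + j)"
  using n_pos by (simp add: potential_W_def reduced_entry_def pW_def reduced_solution_def pos_def)

lemma potential_V_eq: "potential_V S d j = pV d (n + j)"
  using n_pos by (simp add: potential_V_def reduced_entry_def pV_def reduced_solution_def pos_def)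

text \<open>The source of gamma sits at (1,0), which is position 1, so the solution is harmonic from
  position 2 upwards and hence constant from position 1 on. Since \<open>n \<ge> 1\<close>, all
  states (n,j) lie in that range.\<close>

lemma potential_gamma_const:
  assumes "1 \<le> j" "j \<le> m"
  shows "potential_gamma S d (j - 1) = potential_gamma S d j"
proof -
  let ?h = "\<lambda>s. of_bool (s = (1, 0)) :: real"
  have "bd_op \<beta> (\<mu> d) (reduced_solution d ?h) k = 0" if "2 \<le> k" "k \<le> N" for k
    using bd_op_reduced_solution[of k d ?h] that by (auto simp: state_at_def min_def split: if_splits)
  then have "reduced_solution d ?h (n + j - 1) = reduced_solution d ?h (n + j)"
    using bd_op_eq_0_imp_const[of \<beta> N 2 "\<mu> d" "reduced_solution d ?h" "n + j"] assms n_pos \<mu>_pos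
    by (simp add: \<beta>_eq)
  moreover have "potential_gamma S d i = rate1 S * reduced_solution d ?h (n + i)" if "i \<le> m" for i
    using that n_pos neg_inverse_correct(1)[of d]
    by (simp add: potential_gamma_def reduced_entry_def reduced_solution_def pos_def)
  ultimately show ?thesis using assms by simp
qed

section \<open>Positivity of the denominator of the critical price\<close>

text \<open>Testing invariance with the function \<open>real\<close> equates the departure rate,
  which is \<open>avg_A\<close>, with the rate of accepted arrivals. The latter is below
  \<open>lam\<close> because (n,m) rejects arrivals and has positive probability.\<close>

lemma avg_A_less_arrival:
  assumes "d \<in> policies S"
  shows "avg_A S d < lam"
proof -
  have "0 = (\<Sum>k<Suc N. \<pi> d k * \<beta> k - \<pi> d k * \<mu> d k)"
    using \<pi>_invariant[of d real]
  proof (rule trans[OF sym])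
    show "(\<Sum>k<Suc N. \<pi> d k * bd_op \<beta> (\<mu> d) real k) = (\<Sum>k<Suc N. \<pi> d k * \<beta> k - \<pi> d k * \<mu> d k)"
    proof (rule sum.cong)
      fix k
      show "\<pi> d k * bd_op \<beta> (\<mu> d) real k = \<pi> d k * \<beta> k - \<pi> d k * \<mu> d k"
        using \<mu>_low[of 0 d] by (cases k) (simp_all add: bd_op_def algebra_simps)
    qed simp
  qed
  also have "\<dots> = (\<Sum>k<Suc N. \<pi> d k * \<beta> k) - avg_A S d"
    by (simp add: sum_subtractf avg_A_eq rA_eq_\<mu>[OF assms])
  finally have "avg_A S d = (\<Sum>k<Suc N. \<pi> d k * \<beta> k)" by simp
  also have "\<dots> < (\<Sum>k<Suc N. \<pi> d k * lam)"
    using \<pi>_pos[of d] arrival_pos by (intro sum_strict_mono_ex1) (auto simp: \<beta>_eq less_imp_le)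
  also have "\<dots> = lam"
    unfolding sum_distrib_right[symmetric] sum_\<pi> by simp
  finally show ?thesis .
qed

text \<open>Counting departures is counting arrivals up to the change of the state, so
  1 + W(k - 1) - W(k) is the difference of the relative values for accepted arrivals, which
  decrease in the state because of the losses at (n,m).\<close>

lemma pW_diff_pos:
  assumes d: "d \<in> policies S" and "1 \<le> k" "k \<le> N"
  shows "1 + (pW d (k - 1) - pW d k) > 0"
  using \<open>1 \<le> k\<close> \<open>k \<le> N\<close>
proof (induction k rule: dec_induct)
  case base
  have "lam * (pW d 1 - pW d 0) = avg_A S d"
    using bd_op_pW[of 0 d] n_pos by (simp add: bd_op_def \<beta>_eq rA_eq_\<mu>[OF d] \<mu>_low)
  then have "lam * (1 + (pW d 0 - pW d 1)) > 0"
    using avg_A_less_arrival[OF d] by (simp add: algebra_simps)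
  then show ?case using arrival_pos by (simp add: zero_less_mult_iff)
next
  case (step k)
  let ?\<delta> = "\<lambda>k. 1 + (pW d (k - 1) - pW d k)"
  have "lam * (pW d (Suc k) - pW d k) + \<mu> d k * (pW d (k - 1) - pW d k) = avg_A S d - \<mu> d k"
    using bd_op_pW[of k d] step by (simp add: bd_op_def \<beta>_eq rA_eq_\<mu>[OF d])
  \<comment> \<open>In terms of \<open>?\<delta>\<close> the Poisson equation is a first-order
    recursion whose two summands are positive.\<close>
  then have "lam * ?\<delta> (Suc k) = (lam - avg_A S d) + \<mu> d k * ?\<delta> k"
    by (simp add: algebra_simps)
  also have "\<dots> > 0"
    using step avg_A_less_arrival[OF d] \<mu>_pos[of k d] by (simp add: add_pos_pos)
  finally show ?case using arrival_pos by (simp add: zero_less_mult_iff)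
qed

section \<open>Critical prices and the profit difference of two policies\<close>

text \<open>With g = R W - V this is R + g(n,j-1) - g(n,j), the net value of one additional service
  completion in state (n,j).\<close>

definition gain :: "real \<Rightarrow> policy \<Rightarrow> nat \<Rightarrow> real" where
  "gain R d j = R * (1 + (pW d (n + j - 1) - pW d (n + j))) - (pV d (n + j - 1) - pV d (n + j))"

lemma critical_price_eq:
  assumes "1 \<le> j" "j \<le> m"
  shows "critical_price S d j =
    ((pV d (n + j - 1) - pV d (n + j)) + (power2W S - power2S S) * cost1 S / rate2 S)
      / (1 + (pW d (n + j - 1) - pW d (n + j)))"
  using assms potential_gamma_const[OF assms]
  by (simp add: critical_price_def potential_W_eq potential_V_eq)

text \<open>The critical price is the value of R at which the return
  \<open>rate2 S * gain R d j\<close> of a working server of the second group balances the extra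
  power cost of keeping it awake. The denominator is positive by \<open>pW_diff_pos\<close>, so
  clearing it keeps the direction of the inequality.\<close>

lemma price_ge_critical_iff:
  assumes "d \<in> policies S" "1 \<le> j" "j \<le> m"
  shows "critical_price S d j \<le> R \<longleftrightarrow> (power2W S - power2S S) * cost1 S \<le> rate2 S * gain R d j"
    and "R \<le> critical_price S d j \<longleftrightarrow> rate2 S * gain R d j \<le> (power2W S - power2S S) * cost1 S"
proof -
  define \<delta> where "\<delta> = 1 + (pW d (n + j - 1) - pW d (n + j))"
  define v where "v = pV d (n + j - 1) - pV d (n + j)"
  have pos: "\<delta> > 0"
    unfolding \<delta>_def using pW_diff_pos[of d "n + j"] assms by simp
  have eq: "critical_price S d j = (v + (power2W S - power2S S) * cost1 S / rate2 S) / \<delta>"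
    "gain R d j = R * \<delta> - v"
    using assms by (simp_all add: critical_price_eq gain_def \<delta>_def v_def)
  show "critical_price S d j \<le> R \<longleftrightarrow> (power2W S - power2S S) * cost1 S \<le> rate2 S * gain R d j"
    "R \<le> critical_price S d j \<longleftrightarrow> rate2 S * gain R d j \<le> (power2W S - power2S S) * cost1 S"
    unfolding eq pos_divide_le_eq[OF pos] pos_le_divide_eq[OF pos]
    using rate2_pos by (simp_all add: field_simps)
qed

text \<open>Contribution of state (n,j) when \<open>d\<close> is replaced by \<open>d'\<close>: only
  servers with a job, hence at most j, earn, whereas every awake server draws power.\<close>

definition advantage :: "real \<Rightarrow> policy \<Rightarrow> policy \<Rightarrow> nat \<Rightarrow> real" where
  "advantage R d d' j =
    (real (min (d' (n, j)) j) - real (min (d (n, j)) j)) * (rate2 S * gain R d j)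
    - (real (d' (n, j)) - real (d (n, j))) * ((power2W S - power2S S) * cost1 S)"

lemma sum_positions: "(\<Sum>k<Suc N. f k) = (\<Sum>i=0..n. f i) + (\<Sum>j=1..m. f (n + j))"
  for f :: "nat \<Rightarrow> real"
proof -
  have "(\<Sum>k<Suc (n + j). f k) = (\<Sum>i=0..n. f i) + (\<Sum>i=1..j. f (n + i))" for j
    by (induction j) (simp_all add: atLeast0AtMost lessThan_Suc_atMost)
  then show ?thesis .
qed

lemma avg_profit_difference:
  assumes d: "d \<in> policies S" and d': "d' \<in> policies S"
  shows "avg_profit S R d' - avg_profit S R d = (\<Sum>j=1..m. \<pi> d' (n + j) * advantage R d d' j)"
proof -
  define g where "g k = R * pW d k - pV d k" for k
  \<comment> \<open>What is left at position \<open>k\<close> once the Poisson equation of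
    \<open>d\<close> has removed the average profit of \<open>d\<close>: the reward difference plus
    the change of the death rate times the drop of \<open>g\<close>.\<close>
  define f where "f k = (R * rA d' k - cB d' k) - (R * rA d k - cB d k)
    + (\<mu> d' k - \<mu> d k) * (g (k - 1) - g k)" for k
  have g: "bd_op \<beta> (\<mu> d) g k = avg_profit S R d - (R * rA d k - cB d k)" if "k \<le> N" for k
    unfolding g_def bd_op_lincomb bd_op_pW[OF that] bd_op_pV[OF that]
    by (simp add: avg_profit_decomp algebra_simps)
  \<comment> \<open>Averaging the constant \<open>avg_profit S R d\<close> over
    \<open>\<pi> d'\<close> changes nothing, and the added sum is zero because
    \<open>\<pi> d'\<close> is invariant for its own death rates.\<close>
  have "avg_profit S R d' - avg_profit S R d
      = avg_profit S R d' - (\<Sum>k<Suc N. \<pi> d' k * avg_profit S R d)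
        + (\<Sum>k<Suc N. \<pi> d' k * bd_op \<beta> (\<mu> d') g k)"
    unfolding \<pi>_invariant sum_distrib_right[symmetric] sum_\<pi> by simp
  also have "\<dots> = (\<Sum>k<Suc N. \<pi> d' k * (R * rA d' k - cB d' k - avg_profit S R d
      + bd_op \<beta> (\<mu> d') g k))"
    by (simp only: avg_profit_eq[of R d'] distrib_left right_diff_distrib sum.distrib sum_subtractf)
  also have "\<dots> = (\<Sum>k<Suc N. \<pi> d' k * f k)"
  proof (rule sum.cong)
    fix k assume "k \<in> {..<Suc N}"
    then show "\<pi> d' k * (R * rA d' k - cB d' k - avg_profit S R d + bd_op \<beta> (\<mu> d') g k)
        = \<pi> d' k * f k"
      using g[of k] bd_op_diff[of \<beta> "\<mu> d'" g k "\<mu> d"] by (simp add: f_def)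
  qed simp
  also have "\<dots> = (\<Sum>j=1..m. \<pi> d' (n + j) * advantage R d d' j)"
  proof -
    \<comment> \<open>Up to position \<open>n\<close> all policies are 0, so rewards and death rates
      coincide.\<close>
    have "f i = 0" if "i \<le> n" for i
      using d d' that
      by (simp add: f_def rA_def cB_def rev_A_def cost_B_def state_at_def \<mu>_low policies_def)
    moreover have "f (n + j) = advantage R d d' j" if "1 \<le> j" for j
    proof -
      have "\<mu> d' (n + j) - \<mu> d (n + j)
          = (real (min (d' (n, j)) j) - real (min (d (n, j)) j)) * rate2 S"
        unfolding \<mu>_high[OF that] by (simp add: algebra_simps)
      then show ?thesis
        unfolding f_def g_def rA_def cB_def
        using that
        by (simp add: rev_A_def cost_B_def state_at_def advantage_def gain_def min.commute[of j])
          (simp add: algebra_simps)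
    qed
    ultimately show ?thesis unfolding sum_positions by simp
  qed
  finally show ?thesis .
qed

section \<open>Optimality of the full and the sleep policy\<close>

lemma is_arg_max_avg_profit:
  assumes "d \<in> policies S"
    and "\<And>d' j. d' \<in> policies S \<Longrightarrow> 1 \<le> j \<Longrightarrow> j \<le> m \<Longrightarrow> advantage R d d' j \<le> 0"
  shows "is_arg_max (avg_profit S R) (\<lambda>d. d \<in> policies S) d"
  unfolding is_arg_max_def
proof (intro conjI notI)
  assume "\<exists>d'. d' \<in> policies S \<and> avg_profit S R d < avg_profit S R d'"
  then obtain d' where d': "d' \<in> policies S" "avg_profit S R d < avg_profit S R d'" by blast
  have "avg_profit S R d' - avg_profit S R d \<le> 0"
    unfolding avg_profit_difference[OF assms(1) d'(1)]
    using assms(2)[OF d'(1)] \<pi>_pos[of d']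
    by (intro sum_nonpos mult_nonneg_nonpos) (auto simp: less_imp_le)
  with d'(2) show False by simp
qed (fact assms(1))

lemma finite_policies: "finite (policies S)"
proof (rule finite_subset)
  show "policies S \<subseteq> {d. \<forall>s. (s \<in> states S \<longrightarrow> d s \<in> {0..m}) \<and> (s \<notin> states S \<longrightarrow> d s = 0)}"
    by (auto simp: policies_def states_def)
  have "finite (states S)"
    using bij_betw_finite[OF bij_betw_state_at] by blast
  then show "finite {d. \<forall>s. (s \<in> states S \<longrightarrow> d s \<in> {0..m}) \<and> (s \<notin> states S \<longrightarrow> d s = 0)}"
    by (rule finite_set_of_finite_funs) simp
qed

text \<open>Finiteness makes \<open>Max\<close> and \<open>Min\<close> in \<open>price_H\<close> and
  \<open>price_L\<close> genuine bounds.\<close>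

lemma finite_critical_prices:
  "finite {critical_price S d j |d j. d \<in> policies S \<and> j \<in> {1..m}}"
  by (rule finite_image_set2) (simp_all add: finite_policies)

lemma critical_price_le_price_H:
  assumes "d \<in> policies S" "1 \<le> j" "j \<le> m"
  shows "critical_price S d j \<le> price_H S"
  unfolding price_H_def using assms finite_critical_prices by (intro Max_ge) auto

lemma price_L_le_critical_price:
  assumes "d \<in> policies S" "1 \<le> j" "j \<le> m"
  shows "price_L S \<le> critical_price S d j"
  unfolding price_L_def using assms finite_critical_prices by (intro Min_le) auto

lemma full_policy_in: "full_policy S \<in> policies S"
  by (auto simp: full_policy_def policies_def states_def)

lemma sleep_policy_in: "sleep_policy \<in> policies S"
  by (simp add: sleep_policy_def policies_def)

lemma full_policy_optimal:
  assumes "power2S S \<le> power2W S" "0 \<le> cost1 S" and R: "price_H S \<le> R"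
  shows "is_arg_max (avg_profit S R) (\<lambda>d. d \<in> policies S) (full_policy S)"
proof (rule is_arg_max_avg_profit[OF full_policy_in])
  fix d j assume j: "1 \<le> j" "j \<le> m"
  define c where "c = (power2W S - power2S S) * cost1 S"
  define q where "q = rate2 S * gain R (full_policy S) j"
  have "critical_price S (full_policy S) j \<le> R"
    using critical_price_le_price_H[OF full_policy_in j] R by simp
  then have q: "c \<le> q"
    unfolding c_def q_def using price_ge_critical_iff(1)[OF full_policy_in j] by simp
  have c: "0 \<le> c" using assms by (simp add: c_def)
  have adv: "advantage R (full_policy S) d j
      = (real (min (d (n, j)) j) - real j) * q - (real (d (n, j)) - real j) * c"
    using j by (simp add: advantage_def full_policy_def c_def q_def)
  show "advantage R (full_policy S) d j \<le> 0"
  \<comment> \<open>With at most j servers awake, work and power change by the same amount, giving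
    the factor \<open>q - c\<close>. Beyond j the work is capped and only the power cost
    grows.\<close>
  proof (cases "d (n, j) \<le> j")
    case True
    then have "advantage R (full_policy S) d j = (real (d (n, j)) - real j) * (q - c)"
      by (simp add: adv min_def algebra_simps)
    then show ?thesis using True q by (simp add: mult_nonpos_nonneg)
  next
    case False
    then show ?thesis using c by (simp add: adv min_def)
  qed
qed

lemma sleep_policy_optimal:
  assumes "power2S S \<le> power2W S" "0 \<le> cost1 S" and R: "R \<le> price_L S"
  shows "is_arg_max (avg_profit S R) (\<lambda>d. d \<in> policies S) sleep_policy"
proof (rule is_arg_max_avg_profit[OF sleep_policy_in])
  fix d j assume j: "1 \<le> j" "j \<le> m"
  define c where "c = (power2W S - power2S S) * cost1 S"
  define q where "q = rate2 S * gain R sleep_policy j"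
  have "R \<le> critical_price S sleep_policy j"
    using price_L_le_critical_price[OF sleep_policy_in j] R by simp
  then have q: "q \<le> c"
    unfolding c_def q_def using price_ge_critical_iff(2)[OF sleep_policy_in j] by simp
  have c: "0 \<le> c" using assms by (simp add: c_def)
  have "advantage R sleep_policy d j = real (min (d (n, j)) j) * q - real (d (n, j)) * c"
    by (simp add: advantage_def sleep_policy_def c_def q_def)
  \<comment> \<open>A working server returns at most its power cost, so \<open>q\<close> may be
    raised to \<open>c\<close>; what remains is minus the power cost of the awake servers without a
    job.\<close>
  also have "\<dots> \<le> real (min (d (n, j)) j) * c - real (d (n, j)) * c"
    using q by (simp add: mult_left_mono)
  also have "\<dots> \<le> 0"
    using c by (simp add: mult_right_mono)
  finally show "advantage R sleep_policy d j \<le> 0" .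
qed

section \<open>Explicit profit formulas\<close>

lemma wt_low: "i \<le> n \<Longrightarrow> wt d i = lam ^ i / (fact i * rate1 S ^ i)"
proof (induction i)
  case (Suc i)
  then show ?case
    by (simp add: wt_def \<mu>_low algebra_simps)
qed (simp add: wt_def)

lemma wt_high:
  "wt d (n + j) = lam ^ n / (fact n * rate1 S ^ n) * (lam ^ j / (\<Prod>i=1..j. \<mu> d (n + i)))"
proof (induction j)
  case 0
  show ?case by (simp add: wt_low)
next
  case (Suc j)
  have "wt d (n + Suc j) = wt d (n + j) * (lam / \<mu> d (n + Suc j))"
    by (simp add: wt_def)
  with Suc show ?case by (simp add: mult.assoc)
qed

lemma rA_cB_low:
  assumes "d \<in> policies S" "i \<le> n"
  shows "rA d i = real i * rate1 S"
    and "cB d i = (real n * power1W S + real m * power2S S) * cost1 S + real i * cost2_1 S"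
  using assms m_pos by (simp_all add: rA_def cB_def rev_A_def cost_B_def state_at_def policies_def)

lemma rA_cB_high:
  assumes "1 \<le> j"
  shows "rA d (n + j) = real n * rate1 S + real (min j (d (n, j))) * rate2 S"
    and "cB d (n + j) = (real n * power1W S + real (d (n, j)) * power2W S
        + (real m - real (d (n, j))) * power2S S) * cost1 S
      + real n * cost2_1 S + real j * cost2_2 S + real n * rate1 S * cost3 S
      + lam * of_bool (j = m) * cost4 S"
  using assms by (simp_all add: rA_def cB_def rev_A_def cost_B_def state_at_def)

text \<open>\<open>q\<close> stands for a closed form of the product of the death rates beyond
  position \<open>n\<close>, so that one computation covers both policies.\<close>

lemma avg_profit_explicit:
  assumes d: "d \<in> policies S"
    and q: "\<And>j. j \<le> m \<Longrightarrow> (\<Prod>i=1..j. \<mu> d (n + i)) = q j"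
    and b: "b = (\<Sum>i=0..n. lam ^ i / (fact i * rate1 S ^ i))
      + lam ^ n / (fact n * rate1 S ^ n) * (\<Sum>j=1..m. lam ^ j / q j)"
  shows "avg_profit S R d =
      (\<Sum>i=0..n. 1 / b * (lam ^ i / (fact i * rate1 S ^ i))
         * (R * real i * rate1 S - (real n * power1W S + real m * power2S S) * cost1 S
            - real i * cost2_1 S))
      + (\<Sum>j=1..m. 1 / b * (lam ^ n / (fact n * rate1 S ^ n)) * (lam ^ j / q j)
         * (R * (real n * rate1 S + real (min j (d (n, j))) * rate2 S)
            - (real n * cost2_1 S + real j * cost2_2 S)
            - (real n * power1W S + real (d (n, j)) * power2W S
               + (real m - real (d (n, j))) * power2S S) * cost1 S
            - real n * rate1 S * cost3 S - lam * of_bool (j = m) * cost4 S))"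
proof -
  have wt_high': "wt d (n + j) = lam ^ n / (fact n * rate1 S ^ n) * (lam ^ j / q j)" if "j \<le> m" for j
    using wt_high[of d j] q[OF that] by simp
  \<comment> \<open>\<open>b\<close> is the normalizing constant of the product form.\<close>
  have b: "b = (\<Sum>k<Suc N. wt d k)"
    unfolding sum_positions sum_distrib_left b by (simp add: wt_low wt_high')
  have low: "R * rA d i - cB d i
      = R * real i * rate1 S - (real n * power1W S + real m * power2S S) * cost1 S
        - real i * cost2_1 S" if "i \<le> n" for i
    using rA_cB_low[OF d that] by simp
  have high: "R * rA d (n + j) - cB d (n + j)
      = R * (real n * rate1 S + real (min j (d (n, j))) * rate2 S)
        - (real n * cost2_1 S + real j * cost2_2 S)
        - (real n * power1W S + real (d (n, j)) * power2W S
           + (real m - real (d (n, j))) * power2S S) * cost1 S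
        - real n * rate1 S * cost3 S - lam * of_bool (j = m) * cost4 S" if "1 \<le> j" for j
    unfolding rA_cB_high[OF that] by simp
  show ?thesis
    \<comment> \<open>The normalizing sum has to be folded into \<open>b\<close> before
      \<open>sum_positions\<close> splits the sums over positions.\<close>
    unfolding avg_profit_eq \<pi>_def b[symmetric] unfolding sum_positions
    by (intro arg_cong2[where f = "(+)"] sum.cong refl) (simp_all add: low high wt_low wt_high')
qed

end

theorem theorem6:
  fixes n m :: nat
    and lam mu1 mu2 P1W P2W P2S C1 C21 C22 C3 C4 R :: real
    and S :: data_center
    and b b' :: real
  assumes S: "S = \<lparr> n_servers = n, m_servers = m, arrival_rate = lam, rate1 = mu1, rate2 = mu2,
                power1W = P1W, power2W = P2W, power2S = P2S, cost1 = C1,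
                cost2_1 = C21, cost2_2 = C22, cost3 = C3, cost4 = C4 \<rparr>"
    and "n \<ge> 1" and "m \<ge> 1"
    and "lam > 0" and "mu1 \<ge> mu2" and "mu2 > 0"
    and "R \<ge> 0" and "P1W > 0" and "0 < P2S" and "P2S < P2W" and "C1 > 0"
    and "0 \<le> C21" and "C21 \<le> C22" and "C3 \<ge> 0" and "C4 \<ge> 0"
    and b: "b = (\<Sum>i=0..n. lam ^ i / (fact i * mu1 ^ i))
            + lam ^ n / (fact n * mu1 ^ n)
              * (\<Sum>j=1..m. lam ^ j / (\<Prod>i=1..j. real n * mu1 + real i * mu2))"
    and b': "b' = (\<Sum>i=0..n. lam ^ i / (fact i * mu1 ^ i))
             + lam ^ n / (fact n * mu1 ^ n)
               * (\<Sum>j=1..m. lam ^ j / (real n * mu1) ^ j)"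
  shows "(R \<ge> price_H S \<longrightarrow>
            is_arg_max (avg_profit S R) (\<lambda>d. d \<in> policies S) (full_policy S)
            \<and> avg_profit S R (full_policy S) =
                (\<Sum>i=0..n. 1 / b * (lam ^ i / (fact i * mu1 ^ i))
                   * (R * real i * mu1 - (real n * P1W + real m * P2S) * C1 - real i * C21))
                + (\<Sum>j=1..m. 1 / b * (lam ^ n / (fact n * mu1 ^ n))
                   * (lam ^ j / (\<Prod>i=1..j. real n * mu1 + real i * mu2))
                   * (R * (real n * mu1 + real j * mu2) - (real n * C21 + real j * C22)
                      - (real n * P1W + real j * P2W + (real m - real j) * P2S) * C1
                      - real n * mu1 * C3 - lam * of_bool (j = m) * C4)))
         \<and> (0 \<le> R \<and> R \<le> price_L S \<longrightarrow>
            is_arg_max (avg_profit S R) (\<lambda>d. d \<in> policies S) sleep_policy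
            \<and> avg_profit S R sleep_policy =
                (\<Sum>i=0..n. 1 / b' * (lam ^ i / (fact i * mu1 ^ i))
                   * (R * real i * mu1 - (real n * P1W + real m * P2S) * C1 - real i * C21))
                + (\<Sum>j=1..m. 1 / b' * (lam ^ n / (fact n * mu1 ^ n))
                   * (lam ^ j / (real n * mu1) ^ j)
                   * (R * real n * mu1 - (real n * P1W + real m * P2S) * C1
                      - (real n * C21 + real j * C22)
                      - real n * mu1 * C3 - lam * of_bool (j = m) * C4)))"
proof -
  \<comment> \<open>The positivity of \<open>rate1 S\<close> comes from \<open>mu1 \<ge> mu2\<close>
    and \<open>mu2 > 0\<close>.\<close>
  interpret energy_model S
    using assms by unfold_locales auto
  \<comment> \<open>The bound on \<open>j\<close> matters because \<open>full_policy\<close> is 0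
    beyond m.\<close>
  have full: "(\<Prod>i=1..j. \<mu> (full_policy S) (n_servers S + i))
      = (\<Prod>i=1..j. real n * mu1 + real i * mu2)" if "j \<le> m_servers S" for j
    using that by (intro prod.cong) (simp_all add: \<mu>_high, simp_all add: S full_policy_def)
  have sleep: "(\<Prod>i=1..j. \<mu> sleep_policy (n_servers S + i)) = (real n * mu1) ^ j" for j
    by (simp add: \<mu>_high sleep_policy_def) (simp add: S)
  have "avg_profit S R (full_policy S) =
      (\<Sum>i=0..n. 1 / b * (lam ^ i / (fact i * mu1 ^ i))
         * (R * real i * mu1 - (real n * P1W + real m * P2S) * C1 - real i * C21))
      + (\<Sum>j=1..m. 1 / b * (lam ^ n / (fact n * mu1 ^ n))
         * (lam ^ j / (\<Prod>i=1..j. real n * mu1 + real i * mu2))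
         * (R * (real n * mu1 + real j * mu2) - (real n * C21 + real j * C22)
            - (real n * P1W + real j * P2W + (real m - real j) * P2S) * C1
            - real n * mu1 * C3 - lam * of_bool (j = m) * C4))"
    by (subst avg_profit_explicit[OF full_policy_in full])
      (simp_all add: S b full_policy_def)
  moreover have "avg_profit S R sleep_policy =
      (\<Sum>i=0..n. 1 / b' * (lam ^ i / (fact i * mu1 ^ i))
         * (R * real i * mu1 - (real n * P1W + real m * P2S) * C1 - real i * C21))
      + (\<Sum>j=1..m. 1 / b' * (lam ^ n / (fact n * mu1 ^ n)) * (lam ^ j / (real n * mu1) ^ j)
         * (R * real n * mu1 - (real n * P1W + real m * P2S) * C1
            - (real n * C21 + real j * C22)
            - real n * mu1 * C3 - lam * of_bool (j = m) * C4))"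
    by (subst avg_profit_explicit[OF sleep_policy_in sleep, of b'])
      (simp_all add: S b' sleep_policy_def algebra_simps)
  moreover have "power2S S \<le> power2W S" "0 \<le> cost1 S"
    using assms by simp_all
  ultimately show ?thesis
    using full_policy_optimal[of R] sleep_policy_optimal[of R] by blast
qed

end
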